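(* Let the setting and notation be as described in the context; in particular, for every $P\in\mathbb{I}\overline{P}$ and $\Omega\in\mathbb{I}\overline{\Omega}$ let $G^{cv}_{P\times\Omega}$ and $G^{cc}_{P\times\Omega}$ be convex and concave relaxations of $G$ on $P\times\Omega$. Let $\Phi=\{\Omega_i\}_{i=1}^n$ be an interval partition of $\overline{\Omega}$. For every $P\in\mathbb{I}\overline{P}$ and every $\mathbf{p}\in P$, define $$\mathcal{G}^{cv}_{P\times\Phi}(\mathbf{p}) \equiv \sum_{i=1}^n \mathbb{P}(\Omega_i)\,G^{cv}_{P\times\Omega_i}(\mathbf{p},\mathbb{E}[\boldsymbol{\omega}|\Omega_i]),$$ $$\mathcal{G}^{cc}_{P\times\Phi}(\mathbf{p}) \equiv \sum_{i=1}^n \mathbb{P}(\Omega_i)\,G^{cc}_{P\times\Omega_i}(\mathbf{p},\mathbb{E}[\boldsymbol{\omega}|\Omega_i]).$$ Then $\mathcal{G}^{cv}_{P\times\Phi}$ and $\mathcal{G}^{cc}_{P\times\Phi}$ are convex and concave relaxations of $\mathcal{G}$ on $P$, respectively.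
   Context: **Notation.** For $\mathbf{s}^L,\mathbf{s}^U\in\mathbb{R}^n$ with $\mathbf{s}^L\le\mathbf{s}^U$ (componentwise), $[\mathbf{s}^L,\mathbf{s}^U]=\{\mathbf{s}\in\mathbb{R}^n:\mathbf{s}^L\le\mathbf{s}\le\mathbf{s}^U\}$ is a compact $n$-dimensional interval. For $\overline{S}\subset\mathbb{R}^n$, $\mathbb{I}\overline{S}$ denotes the set of all compact interval subsets of $\overline{S}$. **Relaxations.** Let $S\subset\mathbb{R}^n$ be convex and $h:S\to\mathbb{R}$. Functions $h^{cv},h^{cc}:S\to\mathbb{R}$ are convex and concave relaxations of $h$ on $S$, respectively, if $h^{cv}$ is convex on $S$, $h^{cc}$ is concave on $S$, and $h^{cv}(\mathbf{s})\le h(\mathbf{s})\le h^{cc}(\mathbf{s})$ for all $\mathbf{s}\in S$. **Setting.** Let $I=[t_0,t_f]\subset\mathbb{R}$, let $\overline{P}\subset\mathbb{R}^{n_p}$ be a compact $n_p$-dimensional interval, and let $\boldsymbol{\omega}$ be a random vector with probability density function $p:\mathbb{R}^{n_\omega}\to\mathbb{R}$ that is zero outside a compact interval $\overline{\Omega}\subset\mathbb{R}^{n_\omega}$. Let $\mathbf{x}_0:\mathbb{R}^{n_p}\times\mathbb{R}^{n_\omega}\to\mathbb{R}^{n_x}$ and $\mathbf{f}:\mathbb{R}\times\mathbb{R}^{n_p}\times\mathbb{R}^{n_\omega}\times\mathbb{R}^{n_x}\to\mathbb{R}^{n_x}$ be locally Lipschitz continuous, and assume that for every $(\mathbf{p},\boldsymbol{\omega})\in\overline{P}\times\overline{\Omega}$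 the initial value problem $\dot{\mathbf{x}}(t,\mathbf{p},\boldsymbol{\omega})=\mathbf{f}(t,\mathbf{p},\boldsymbol{\omega},\mathbf{x}(t,\mathbf{p},\boldsymbol{\omega}))$, $\mathbf{x}(t_0,\mathbf{p},\boldsymbol{\omega})=\mathbf{x}_0(\mathbf{p},\boldsymbol{\omega})$ has a unique solution $\mathbf{x}(\cdot,\mathbf{p},\boldsymbol{\omega})$ on all of $I$. Let $g:\mathbb{R}^{n_p}\times\mathbb{R}^{n_\omega}\times\mathbb{R}^{n_x}\to\mathbb{R}$, let $G(\mathbf{p},\boldsymbol{\omega})\equiv g(\mathbf{p},\boldsymbol{\omega},\mathbf{x}(t_f,\mathbf{p},\boldsymbol{\omega}))$, and define $$\mathcal{G}(\mathbf{p})\equiv\mathbb{E}[G(\mathbf{p},\boldsymbol{\omega})]=\int_{\overline{\Omega}}g(\mathbf{p},\boldsymbol{\omega},\mathbf{x}(t_f,\mathbf{p},\boldsymbol{\omega}))\,p(\boldsymbol{\omega})\,d\boldsymbol{\omega},$$ which is assumed to exist for every $\mathbf{p}\in\overline{P}$. **Standing assumption.** For every $P\in\mathbb{I}\overline{P}$ and $\Omega\in\mathbb{I}\overline{\Omega}$, convex and concave relaxations $G^{cv}_{P\times\Omega},G^{cc}_{P\times\Omega}:P\times\Omega\to\mathbb{R}$ of $G$ on $P\times\Omega$ (jointly in $(\mathbf{p},\boldsymbol{\omega})$) are available. **Interval partition.** A collection $\Phi=\{\Omega_i\}_{i=1}^n$ of intervals $\Omega_i\in\mathbb{I}\overline{\Omega}$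 is an interval partition of $\overline{\Omega}$ if $\overline{\Omega}=\bigcup_{i=1}^n\Omega_i$ and $\mathrm{int}(\Omega_i)\cap\mathrm{int}(\Omega_j)=\emptyset$ for all distinct $i,j$. **Conditional expectation.** For measurable $\Omega\subset\overline{\Omega}$, $\mathbb{P}(\Omega)$ denotes the probability of the event $\boldsymbol{\omega}\in\Omega$ and $\mathbb{E}[\cdot|\Omega]$ denotes the conditional expected value conditioned on the event $\boldsymbol{\omega}\in\Omega$. *)

theory Defs
  imports "HOL-Probability.Probability"
begin

text \<open>The order on \<^typ>\<open>real ^ 'n\<close> is componentwise, so \<open>{a..b}\<close> is the box \<open>cbox a b\<close>.
  Degenerate boxes are allowed, the empty one is not.\<close>
definition compact_intervals :: "'a::order set \<Rightarrow> 'a set set" where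
  "compact_intervals S = {{a..b} | a b. a \<le> b \<and> {a..b} \<subseteq> S}"

text \<open>Convexity of the domain is part of \<^const>\<open>convex_on\<close> and \<^const>\<open>concave_on\<close>.\<close>
definition convex_relaxation_on ::
    "'a::real_vector set \<Rightarrow> ('a \<Rightarrow> real) \<Rightarrow> ('a \<Rightarrow> real) \<Rightarrow> bool" where
  "convex_relaxation_on S h hcv \<longleftrightarrow> convex_on S hcv \<and> (\<forall>s\<in>S. hcv s \<le> h s)"

definition concave_relaxation_on ::
    "'a::real_vector set \<Rightarrow> ('a \<Rightarrow> real) \<Rightarrow> ('a \<Rightarrow> real) \<Rightarrow> bool" where
  "concave_relaxation_on S h hcc \<longleftrightarrow> concave_on S hcc \<and> (\<forall>s\<in>S. h s \<le> hcc s)"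

definition locally_lipschitz :: "('a::metric_space \<Rightarrow> 'b::metric_space) \<Rightarrow> bool" where
  "locally_lipschitz h \<longleftrightarrow> (\<forall>z. \<exists>u>0. \<exists>L. L-lipschitz_on (cball z u) h)"

definition solves_ivp ::
    "real \<Rightarrow> real \<Rightarrow> (real \<Rightarrow> 'a \<Rightarrow> 'a) \<Rightarrow> 'a \<Rightarrow> (real \<Rightarrow> 'a::real_normed_vector) \<Rightarrow> bool" where
  "solves_ivp t0 tf F y0 y \<longleftrightarrow>
     y t0 = y0 \<and>
     (\<forall>t\<in>{t0..tf}. (y has_vector_derivative F t (y t)) (at t within {t0..tf}))"

definition is_unique_ivp_solution ::
    "real \<Rightarrow> real \<Rightarrow> (real \<Rightarrow> 'a \<Rightarrow> 'a) \<Rightarrow> 'a \<Rightarrow> (real \<Rightarrow> 'a::real_normed_vector) \<Rightarrow> bool" where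
  "is_unique_ivp_solution t0 tf F y0 y \<longleftrightarrow>
     solves_ivp t0 tf F y0 y \<and>
     (\<forall>z. solves_ivp t0 tf F y0 z \<longrightarrow> (\<forall>t\<in>{t0..tf}. z t = y t))"

definition interval_partition ::
    "(real ^ 'n) set \<Rightarrow> nat \<Rightarrow> (nat \<Rightarrow> (real ^ 'n) set) \<Rightarrow> bool" where
  "interval_partition S n \<Phi> \<longleftrightarrow>
     (\<forall>i\<in>{1..n}. \<Phi> i \<in> compact_intervals S) \<and>
     S = (\<Union>i\<in>{1..n}. \<Phi> i) \<and>
     (\<forall>i\<in>{1..n}. \<forall>j\<in>{1..n}. i \<noteq> j \<longrightarrow> interior (\<Phi> i) \<inter> interior (\<Phi> j) = {})"

text \<open>The conditional expectation of \<open>X\<close> given the event \<open>A\<close>; it is \<open>0\<close> if \<open>A\<close> is a null event.\<close>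
definition cond_expectation ::
    "'s measure \<Rightarrow> ('s \<Rightarrow> 'b::{banach, second_countable_topology}) \<Rightarrow> 's set \<Rightarrow> 'b" where
  "cond_expectation M X A = (LINT s:A|M. X s) /\<^sub>R measure M A"

definition terminal_value ::
    "('p \<Rightarrow> 'w \<Rightarrow> 'x \<Rightarrow> real) \<Rightarrow> (real \<Rightarrow> 'p \<Rightarrow> 'w \<Rightarrow> 'x) \<Rightarrow> real \<Rightarrow> 'p \<Rightarrow> 'w \<Rightarrow> real" where
  "terminal_value g x tf p w = g p w (x tf p w)"

text \<open>The expected value of \<open>G p\<close> at a random vector with density \<open>\<rho>\<close> vanishing outside \<open>W\<close>.
  The integral over \<open>W\<close> is used rather than an integral over the underlying probability space because
  \<open>G p\<close> is only meaningful on \<open>W\<close>; lemma \<open>expected_value_eq_expectation\<close> relates the two.\<close>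
definition expected_value ::
    "('w::euclidean_space) set \<Rightarrow> ('w \<Rightarrow> real) \<Rightarrow> ('p \<Rightarrow> 'w \<Rightarrow> real) \<Rightarrow> 'p \<Rightarrow> real" where
  "expected_value W \<rho> G p = (LINT w:W|lebesgue. G p w * \<rho> w)"

definition expected_value_exists ::
    "('w::euclidean_space) set \<Rightarrow> ('w \<Rightarrow> real) \<Rightarrow> ('p \<Rightarrow> 'w \<Rightarrow> real) \<Rightarrow> 'p \<Rightarrow> bool" where
  "expected_value_exists W \<rho> G p \<longleftrightarrow> set_integrable lebesgue W (\<lambda>w. G p w * \<rho> w)"

lemma expected_value_eq_expectation:
  fixes \<omega> :: "'s \<Rightarrow> 'w::euclidean_space"
  assumes "distributed M lborel \<omega> (\<lambda>w. ennreal (\<rho> w))"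
    and nonneg: "\<And>w. 0 \<le> \<rho> w" and zero: "\<And>w. w \<notin> W \<Longrightarrow> \<rho> w = 0"
    and meas: "G p \<in> borel_measurable borel"
  shows "expected_value W \<rho> G p = (LINT s|M. G p (\<omega> s))"
proof -
  have [measurable]: "\<rho> \<in> borel_measurable borel"
    using distributed_real_measurable[OF _ assms(1)] nonneg by simp
  have "expected_value W \<rho> G p = (LINT w|lebesgue. \<rho> w * G p w)"
    unfolding expected_value_def set_lebesgue_integral_def
    by (rule Bochner_Integration.integral_cong) (use zero in \<open>auto simp: indicator_def\<close>)
  also have "\<dots> = (LINT w|lborel. \<rho> w * G p w)"
    by (rule integral_completion) (use meas in measurable)
  also have "\<dots> = (LINT s|M. G p (\<omega> s))"
    by (rule distributed_integral[OF assms(1)]) (use meas nonneg in auto)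
  finally show ?thesis .
qed

text \<open>\<open>R P (\<Phi> i)\<close> is the relaxation associated with \<open>P \<times> \<Phi> i\<close>. Summands with a null event \<open>\<omega> \<in> \<Phi> i\<close>
  vanish.\<close>
definition partition_relaxation ::
    "'s measure \<Rightarrow> ('s \<Rightarrow> real ^ 'w) \<Rightarrow> nat \<Rightarrow> (nat \<Rightarrow> (real ^ 'w) set) \<Rightarrow>
     ('p set \<Rightarrow> (real ^ 'w) set \<Rightarrow> 'p \<times> (real ^ 'w) \<Rightarrow> real) \<Rightarrow> 'p set \<Rightarrow> 'p \<Rightarrow> real" where
  "partition_relaxation M \<omega> n \<Phi> R P p =
     (\<Sum>i=1..n. measure M {s \<in> space M. \<omega> s \<in> \<Phi> i} *
        R P (\<Phi> i) (p, cond_expectation M \<omega> {s \<in> space M. \<omega> s \<in> \<Phi> i}))"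

end

theory Submission imports Defs begin

text \<open>Split the expected value over the cells (their overlaps are null sets) and apply Jensen's
  inequality to the convex function \<open>w \<mapsto> G\<^sup>c\<^sup>v (p, w)\<close> on each cell. A relaxation may be nonmeasurable
  and discontinuous on the boundary of its cell, so Jensen's inequality is proved with a supporting
  hyperplane of the epigraph at the conditional mean. That hyperplane is not vertical because
  the distribution has a density: otherwise the mass of the cell would be concentrated on a
  hyperplane. Convexity in \<open>p\<close> is clear once the conditional mean is known to lie in the cell, and
  the concave case follows by negation.\<close>

section \<open>Convex functions: separation at a point and finite sums\<close>

text \<open>The strict epigraph \<open>E\<close> is convex and misses \<open>(m, \<phi> m)\<close>,
  so a hyperplane separates the two; \<open>E\<close> is unbounded upwards, which forces
  \<open>0 \<le> b\<close>. The point \<open>m\<close> is arbitrary. At this stage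
  \<open>b = 0\<close>, a vertical hyperplane, is still possible.\<close>

lemma convex_on_separation:
  fixes \<phi> :: "'a::euclidean_space \<Rightarrow> real"
  assumes "convex_on W \<phi>" "W \<noteq> {}"
  obtains a b where "a \<noteq> 0 \<or> b \<noteq> 0" "0 \<le> b"
    "\<And>w. w \<in> W \<Longrightarrow> a \<bullet> m + b * \<phi> m \<le> a \<bullet> w + b * \<phi> w"
proof -
  define E where "E = {z. fst z \<in> W \<and> \<phi> (fst z) < snd z}"
  have "convex E"
  proof (rule convexI)
    fix y z :: "'a \<times> real" and u v :: real
    assume yz: "y \<in> E" "z \<in> E" and uv: "0 \<le> u" "0 \<le> v" "u + v = 1"
    have "u *\<^sub>R fst y + v *\<^sub>R fst z \<in> W"
      using convex_on_imp_convex[OF assms(1)] yz uv unfolding E_def convex_def by auto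
    moreover have "\<phi> (u *\<^sub>R fst y + v *\<^sub>R fst z) \<le> u * \<phi> (fst y) + v * \<phi> (fst z)"
      using assms(1) yz uv by (auto simp: convex_on_def E_def)
    \<comment> \<open>One strict summand suffices: the first if \<open>u\<close> is positive,
      otherwise the second, since then \<open>v = 1\<close>.\<close>
    moreover have "u * \<phi> (fst y) + v * \<phi> (fst z) < u * snd y + v * snd z"
    proof (cases "u = 0")
      case True
      then show ?thesis using yz uv by (auto simp: E_def)
    next
      case False
      then show ?thesis using yz uv
        by (intro add_less_le_mono mult_strict_left_mono mult_left_mono) (auto simp: E_def)
    qed
    ultimately show "u *\<^sub>R y + v *\<^sub>R z \<in> E"
      by (auto simp: E_def)
  qed
  moreover from \<open>W \<noteq> {}\<close> obtain w0 where "w0 \<in> W" by auto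
  then have "(w0, \<phi> w0 + 1) \<in> E" by (simp add: E_def)
  then have "E \<noteq> {}" by auto
  moreover have "{(m, \<phi> m)} \<inter> E = {}" by (auto simp: E_def)
  ultimately obtain c d where c: "c \<noteq> 0" "c \<bullet> (m, \<phi> m) \<le> d" "\<And>z. z \<in> E \<Longrightarrow> d \<le> c \<bullet> z"
    using separating_hyperplane_sets[of "{(m, \<phi> m)}" E]
    by (metis convex_singleton insert_not_empty singletonI)
  obtain a b where ab: "c = (a, b)" by (cases c)
  have above: "a \<bullet> m + b * \<phi> m \<le> a \<bullet> w + b * y" if "w \<in> W" "\<phi> w < y" for w y
    using c(3)[of "(w, y)"] c(2) that by (auto simp: ab E_def)
  have "0 \<le> b"
  proof (rule ccontr)
    assume "\<not> 0 \<le> b"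
    \<comment> \<open>The first entry of the maximum puts \<open>(w0, K)\<close> into
      \<open>E\<close>. As \<open>b\<close> is negative, the second makes the functional at this
      point smaller than at \<open>(m, \<phi> m)\<close> by at least 1, against
      \<open>above\<close>.\<close>
    define K where "K = max (\<phi> w0 + 1) ((a \<bullet> m + b * \<phi> m - a \<bullet> w0 - 1) / b)"
    have "b * K \<le> a \<bullet> m + b * \<phi> m - a \<bullet> w0 - 1"
      using \<open>\<not> 0 \<le> b\<close> mult_left_mono_neg[of "(a \<bullet> m + b * \<phi> m - a \<bullet> w0 - 1) / b" K b]
      by (auto simp: K_def)
    moreover have "\<phi> w0 < K" by (simp add: K_def less_max_iff_disj)
    ultimately show False using above[OF \<open>w0 \<in> W\<close>] by force
  qed
  moreover have "a \<bullet> m + b * \<phi> m \<le> a \<bullet> w + b * \<phi> w" if "w \<in> W" for w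
  proof (rule field_le_epsilon)
    fix e :: real assume "0 < e"
    \<comment> \<open>The graph itself is not in \<open>E\<close>, so it is approached from above.
      Dividing by \<open>b + 1\<close> instead of \<open>b\<close> covers \<open>b = 0\<close> as
      well.\<close>
    have "b * (e / (b + 1)) \<le> e"
      using \<open>0 \<le> b\<close> \<open>0 < e\<close> by (simp add: field_simps)
    moreover have "0 < e / (b + 1)"
      using \<open>0 \<le> b\<close> \<open>0 < e\<close> by simp
    ultimately show "a \<bullet> m + b * \<phi> m \<le> a \<bullet> w + b * \<phi> w + e"
      using above[OF that, of "\<phi> w + e / (b + 1)"] by (simp add: distrib_left)
  qed
  moreover have "a \<noteq> 0 \<or> b \<noteq> 0" using c(1) ab by (auto simp: zero_prod_def)
  ultimately show thesis using that by blast
qed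

lemma convex_on_finite_sum:
  assumes "convex S" "\<And>i. i \<in> I \<Longrightarrow> convex_on S (f i)"
  shows "convex_on S (\<lambda>x. \<Sum>i\<in>I. f i x)"
  using assms(2)
proof (induction I rule: infinite_finite_induct)
  case (insert i I)
  then have "convex_on S (\<lambda>x. f i x + (\<Sum>i\<in>I. f i x))"
    by (intro convex_on_add) simp_all
  with insert.hyps show ?case by simp
qed (simp_all add: convex_on_const \<open>convex S\<close>)

section \<open>Barycenters of nonnegative weights and Jensen's inequality\<close>

text \<open>The weight is not normalised: for a cell \<open>W\<close> of positive probability,
  \<open>r\<close> will be the density cut off outside \<open>W\<close>, its integral the
  probability of the cell, and \<open>m\<close> the conditional mean.\<close>

locale weighted_barycenter =
  fixes W :: "'a::euclidean_space set" and r :: "'a \<Rightarrow> real" and m :: 'a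
  assumes integrable_weight: "integrable lebesgue r"
    and integrable_moment: "integrable lebesgue (\<lambda>w. r w *\<^sub>R w)"
    and weight_nonneg: "\<And>w. 0 \<le> r w"
    and weight_outside: "\<And>w. w \<notin> W \<Longrightarrow> r w = 0"
    and weight_pos: "0 < integral\<^sup>L lebesgue r"
    and barycenter: "(LINT w|lebesgue. r w *\<^sub>R w) = integral\<^sup>L lebesgue r *\<^sub>R m"
begin

lemma integrable_affine: "integrable lebesgue (\<lambda>w. r w * (a \<bullet> (w - m)))"
proof -
  have "integrable lebesgue (\<lambda>w. a \<bullet> (r w *\<^sub>R w) - r w * (a \<bullet> m))"
    by (intro Bochner_Integration.integrable_diff integrable_inner_right integrable_mult_left
        integrable_moment integrable_weight)
  then show ?thesis by (simp add: inner_diff_right algebra_simps)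
qed

lemma integral_affine: "(LINT w|lebesgue. r w * (a \<bullet> (w - m))) = 0"
proof -
  have "(LINT w|lebesgue. r w * (a \<bullet> (w - m)))
      = (LINT w|lebesgue. a \<bullet> (r w *\<^sub>R w) - r w * (a \<bullet> m))"
    by (simp add: inner_diff_right algebra_simps)
  also have "\<dots> = a \<bullet> (LINT w|lebesgue. r w *\<^sub>R w) - integral\<^sup>L lebesgue r * (a \<bullet> m)"
    using integrable_moment integrable_weight
    by (subst Bochner_Integration.integral_diff)
      (simp_all del: inner_scaleR_right)
  finally show ?thesis by (simp add: barycenter)
qed

text \<open>A nonnegative integrand with integral \<open>0\<close> vanishes almost everywhere, but hyperplanes are null
  sets.\<close>
lemma no_supporting_hyperplane:
  assumes "\<And>w. w \<in> W \<Longrightarrow> a \<bullet> m \<le> a \<bullet> w"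
  shows "a = 0"
proof (rule ccontr)
  assume "a \<noteq> 0"
  have "AE w in lebesgue. 0 \<le> r w * (a \<bullet> (w - m))"
  proof (rule AE_I2)
    fix w
    show "0 \<le> r w * (a \<bullet> (w - m))"
      using assms[of w] weight_nonneg[of w] weight_outside[of w]
      by (cases "w \<in> W") (auto simp: inner_diff_right)
  qed
  then have "AE w in lebesgue. r w * (a \<bullet> (w - m)) = 0"
    using integral_nonneg_eq_0_iff_AE[OF integrable_affine] integral_affine by blast
  moreover have "{w. a \<bullet> w = a \<bullet> m} \<in> null_sets lebesgue"
    using negligible_hyperplane[of a "a \<bullet> m"] \<open>a \<noteq> 0\<close> by (simp add: negligible_iff_null_sets)
  then have "AE w in lebesgue. a \<bullet> w \<noteq> a \<bullet> m"
    using AE_not_in by fastforce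
  ultimately have "AE w in lebesgue. r w = 0"
    by eventually_elim (auto simp: inner_diff_right)
  then have "integral\<^sup>L lebesgue r = 0"
    by (simp add: integral_eq_zero_AE)
  then show False using weight_pos by simp
qed

lemma nonempty: "W \<noteq> {}"
proof
  assume "W = {}"
  then have "r = (\<lambda>_. 0)" using weight_outside by auto
  then show False using weight_pos by simp
qed

text \<open>A point outside a convex set is weakly separated from it by some nonzero
  \<open>a\<close>, even if the set is not closed; such an \<open>a\<close> is excluded by
  \<open>no_supporting_hyperplane\<close>.\<close>

lemma barycenter_mem:
  assumes "convex W"
  shows "m \<in> W"
proof (rule ccontr)
  assume "m \<notin> W"
  then obtain a d where "a \<noteq> 0" "a \<bullet> m \<le> d" "\<And>w. w \<in> W \<Longrightarrow> d \<le> a \<bullet> w"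
    using separating_hyperplane_sets[of "{m}" W] assms nonempty by auto
  then show False using no_supporting_hyperplane[of a] by force
qed

text \<open>The separating hyperplane cannot be vertical, so it gives an affine minorant of \<open>\<phi>\<close> that is exact at
  \<open>m\<close>; only this minorant, not the possibly nonmeasurable \<open>\<phi>\<close>, is integrated.\<close>
lemma jensen:
  assumes \<phi>: "convex_on W \<phi>" and le: "\<And>w. w \<in> W \<Longrightarrow> \<phi> w \<le> h w"
    and h: "integrable lebesgue (\<lambda>w. r w * h w)"
  shows "integral\<^sup>L lebesgue r * \<phi> m \<le> (LINT w|lebesgue. r w * h w)"
proof -
  obtain a b where ab: "a \<noteq> 0 \<or> b \<noteq> 0" "0 \<le> b"
    and sep: "\<And>w. w \<in> W \<Longrightarrow> a \<bullet> m + b * \<phi> m \<le> a \<bullet> w + b * \<phi> w"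
    using convex_on_separation[OF \<phi> nonempty] by blast
  \<comment> \<open>With \<open>b = 0\<close> the vector \<open>a\<close> would support
    \<open>W\<close> at \<open>m\<close>, hence vanish, and both coefficients would be zero.\<close>
  have "b \<noteq> 0"
    using no_supporting_hyperplane[of a] sep ab(1) by auto
  with ab(2) have b: "0 < b" by simp
  \<comment> \<open>The affine term has integral 0 because \<open>m\<close> is the barycenter, so
    subtracting it changes nothing.\<close>
  have "integral\<^sup>L lebesgue r * (b * \<phi> m)
      = (LINT w|lebesgue. r w * (b * \<phi> m) - r w * (a \<bullet> (w - m)))"
    using integrable_weight integrable_affine[of a]
    by (subst Bochner_Integration.integral_diff) (auto simp: integral_affine)
  also have "\<dots> \<le> (LINT w|lebesgue. b * (r w * h w))"
  proof (rule integral_mono)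
    fix w
    show "r w * (b * \<phi> m) - r w * (a \<bullet> (w - m)) \<le> b * (r w * h w)"
    proof (cases "w \<in> W")
      case True
      have "b * \<phi> m - a \<bullet> (w - m) \<le> b * h w"
        using sep[OF True] mult_left_mono[OF le[OF True] ab(2)] by (simp add: inner_diff_right)
      from mult_left_mono[OF this weight_nonneg[of w]] show ?thesis
        by (simp add: algebra_simps)
    qed (simp add: weight_outside)
  qed (intro Bochner_Integration.integrable_diff integrable_mult_left integrable_mult_right
      integrable_weight integrable_affine h)+
  also have "\<dots> = b * (LINT w|lebesgue. r w * h w)"
    by simp
  finally have "b * (integral\<^sup>L lebesgue r * \<phi> m) \<le> b * (LINT w|lebesgue. r w * h w)"
    by (simp add: mult.left_commute)
  then show ?thesis using b by simp
qed

end

section \<open>Boxes and interval partitions\<close>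

lemma compact_intervals_cart:
  fixes S :: "(real ^ 'n) set"
  assumes "X \<in> compact_intervals S"
  shows "compact X" "convex X" "X \<subseteq> S"
  using assms unfolding compact_intervals_def
  by (auto simp: interval_cbox_cart compact_cbox convex_box)

text \<open>The overlap of two distinct cells is convex with empty interior, hence a Lebesgue null
  set. This also covers degenerate cells and a degenerate cell listed twice.\<close>

lemma integral_interval_partition:
  fixes h :: "real ^ 'n \<Rightarrow> 'b::{banach, second_countable_topology}"
  assumes part: "interval_partition S n \<Phi>" and h: "set_integrable lebesgue S h"
  shows "(LINT w:S|lebesgue. h w) = (\<Sum>i=1..n. LINT w:\<Phi> i|lebesgue. h w)"
proof -
  have mem: "\<Phi> i \<in> compact_intervals S" if "i \<in> {1..n}" for i
    using part that by (auto simp: interval_partition_def)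
  have sets: "\<Phi> i \<in> sets lebesgue" if "i \<in> {1..n}" for i
    using compact_intervals_cart(1)[OF mem[OF that]] by (simp add: compact_imp_closed)
  have ae: "AE w in lebesgue. w \<in> \<Phi> i \<and> w \<in> \<Phi> j \<longrightarrow> i = j"
    if "i \<in> {1..n}" "j \<in> {1..n}" for i j
  proof (cases "i = j")
    case False
    then have "interior (\<Phi> i \<inter> \<Phi> j) = {}"
      using part that by (simp add: interval_partition_def)
    moreover have "convex (\<Phi> i \<inter> \<Phi> j)"
      using compact_intervals_cart(2) mem that by (intro convex_Int) blast+
    ultimately have "\<Phi> i \<inter> \<Phi> j \<in> null_sets lebesgue"
      using negligible_convex_interior negligible_iff_null_sets by blast
    then have "AE w in lebesgue. w \<notin> \<Phi> i \<inter> \<Phi> j" by (rule AE_not_in)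
    then show ?thesis by eventually_elim auto
  qed simp
  have S: "S = (\<Union>i\<in>{1..n}. \<Phi> i)"
    using part by (simp add: interval_partition_def)
  have "set_integrable lebesgue (\<Phi> i) h" if "i \<in> {1..n}" for i
    using h sets[OF that] compact_intervals_cart(3)[OF mem[OF that]]
    by (rule set_integrable_subset)
  then show ?thesis
    by (subst S, intro set_integral_finite_UN_AE) (use ae sets in auto)
qed

section \<open>Mass, mean and Jensen's inequality on a cell for a random vector with a
  density\<close>

context
  fixes M :: "'s measure" and \<omega> :: "'s \<Rightarrow> real ^ 'n" and \<rho> :: "real ^ 'n \<Rightarrow> real"
  assumes prob: "prob_space M"
    and dist: "distributed M lborel \<omega> (\<lambda>w. ennreal (\<rho> w))"
    and nonneg: "\<And>w. 0 \<le> \<rho> w"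
begin

lemma measurable_density [measurable]: "\<rho> \<in> borel_measurable borel"
  using distributed_real_measurable[OF _ dist] nonneg by simp

lemma measurable_random_vector [measurable]: "\<omega> \<in> borel_measurable M"
  using distributed_measurable[OF dist] by simp

text \<open>Change of variables from \<open>M\<close> to Lebesgue measure. Vector values allow one
  statement to serve both the probability of a cell and its first moment.\<close>

lemma distributed_integral_vector:
  fixes h :: "real ^ 'n \<Rightarrow> 'b::{banach, second_countable_topology}"
  assumes [measurable]: "h \<in> borel_measurable borel"
  shows "(LINT s|M. h (\<omega> s)) = (LINT w|lebesgue. \<rho> w *\<^sub>R h w)"
    and "integrable M (\<lambda>s. h (\<omega> s)) \<longleftrightarrow> integrable lebesgue (\<lambda>w. \<rho> w *\<^sub>R h w)"
proof -
  have d: "distr M lborel \<omega> = density lborel (\<lambda>w. ennreal (\<rho> w))"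
    using dist by (rule distributed_distr_eq_density)
  have "(LINT s|M. h (\<omega> s)) = integral\<^sup>L (distr M lborel \<omega>) h"
    by (subst integral_distr) auto
  also have "\<dots> = (LINT w|lborel. \<rho> w *\<^sub>R h w)"
    unfolding d by (subst integral_density) (auto simp: nonneg)
  also have "\<dots> = (LINT w|lebesgue. \<rho> w *\<^sub>R h w)"
    by (subst integral_completion) auto
  finally show "(LINT s|M. h (\<omega> s)) = (LINT w|lebesgue. \<rho> w *\<^sub>R h w)" .
  have "integrable M (\<lambda>s. h (\<omega> s)) \<longleftrightarrow> integrable (distr M lborel \<omega>) h"
    by (subst integrable_distr_eq) auto
  also have "\<dots> \<longleftrightarrow> integrable lborel (\<lambda>w. \<rho> w *\<^sub>R h w)"
    unfolding d by (subst integrable_density) (auto simp: nonneg)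
  also have "\<dots> \<longleftrightarrow> integrable lebesgue (\<lambda>w. \<rho> w *\<^sub>R h w)"
    by (subst integrable_completion) auto
  finally show "integrable M (\<lambda>s. h (\<omega> s)) \<longleftrightarrow> integrable lebesgue (\<lambda>w. \<rho> w *\<^sub>R h w)" .
qed

lemma
  assumes "compact W"
  shows measure_eq_integral_density:
      "measure M {s \<in> space M. \<omega> s \<in> W} = (LINT w|lebesgue. \<rho> w * indicator W w)"
    and integrable_density: "integrable lebesgue (\<lambda>w. \<rho> w * indicator W w)"
    and moment_eq_integral_density:
      "(LINT s:{s \<in> space M. \<omega> s \<in> W}|M. \<omega> s) = (LINT w|lebesgue. (\<rho> w * indicator W w) *\<^sub>R w)"
    and integrable_density_moment: "integrable lebesgue (\<lambda>w. (\<rho> w * indicator W w) *\<^sub>R w)"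
proof -
  interpret prob_space M by (rule prob)
  have [measurable]: "W \<in> sets borel"
    using assms by (simp add: compact_imp_closed)
  let ?A = "{s \<in> space M. \<omega> s \<in> W}"
  have ind: "indicator W (\<omega> s) = (indicator ?A s :: real)" if "s \<in> space M" for s
    using that by (simp add: indicator_def)
  have A: "?A \<in> sets M" by measurable
  have "measure M ?A = (LINT s|M. indicator ?A s)"
    using A by simp
  also have "\<dots> = (LINT s|M. indicator W (\<omega> s))"
    by (rule Bochner_Integration.integral_cong) (simp_all add: ind)
  also have "\<dots> = (LINT w|lebesgue. \<rho> w * indicator W w)"
    by (subst distributed_integral_vector) auto
  finally show "measure M ?A = (LINT w|lebesgue. \<rho> w * indicator W w)" .
  have "integrable M (\<lambda>s. indicator W (\<omega> s) :: real)"
    by (rule integrable_const_bound[of _ 1]) (auto simp: indicator_def)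
  then show "integrable lebesgue (\<lambda>w. \<rho> w * indicator W w)"
    by (subst (asm) distributed_integral_vector) auto
  have "(LINT s:?A|M. \<omega> s) = (LINT s|M. indicator W (\<omega> s) *\<^sub>R \<omega> s)"
    unfolding set_lebesgue_integral_def
    by (rule Bochner_Integration.integral_cong) (simp_all add: ind)
  also have "\<dots> = (LINT w|lebesgue. (\<rho> w * indicator W w) *\<^sub>R w)"
    by (subst distributed_integral_vector[where h = "\<lambda>w. indicator W w *\<^sub>R w"]) auto
  finally show "(LINT s:?A|M. \<omega> s) = (LINT w|lebesgue. (\<rho> w * indicator W w) *\<^sub>R w)" .
  obtain B where B: "0 < B" "\<And>w. w \<in> W \<Longrightarrow> norm w \<le> B"
    using compact_imp_bounded[OF assms] unfolding bounded_pos by blast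
  \<comment> \<open>No moment of \<open>\<omega>\<close> itself is assumed: its truncation to the
    compact set \<open>W\<close> is bounded by \<open>B\<close>, and \<open>M\<close> is a finite
    measure.\<close>
  have "integrable M (\<lambda>s. indicator W (\<omega> s) *\<^sub>R \<omega> s)"
    by (rule integrable_const_bound[of _ B]) (use B in \<open>auto simp: indicator_def\<close>)
  then show "integrable lebesgue (\<lambda>w. (\<rho> w * indicator W w) *\<^sub>R w)"
    by (subst (asm) distributed_integral_vector[where h = "\<lambda>w. indicator W w *\<^sub>R w"]) auto
qed

text \<open>Positive probability is what allows the division in \<open>cond_expectation\<close> to
  be undone, which gives the barycenter equation.\<close>

lemma weighted_barycenter_cond_expectation:
  assumes "compact W" "0 < measure M {s \<in> space M. \<omega> s \<in> W}"
  shows "weighted_barycenter W (\<lambda>w. \<rho> w * indicator W w)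
    (cond_expectation M \<omega> {s \<in> space M. \<omega> s \<in> W})"
  using assms integrable_density[OF assms(1)] integrable_density_moment[OF assms(1)] nonneg
  by unfold_locales
    (auto simp: cond_expectation_def moment_eq_integral_density
      measure_eq_integral_density[symmetric])

text \<open>The integral stays on the Lebesgue side since only the product of \<open>h\<close> and
  \<open>\<rho>\<close> is known to be integrable over \<open>W\<close>; \<open>h\<close> alone may
  be nonmeasurable.\<close>

lemma jensen_cond_expectation:
  assumes W: "compact W" and \<phi>: "convex_on W \<phi>" and le: "\<And>w. w \<in> W \<Longrightarrow> \<phi> w \<le> h w"
    and h: "set_integrable lebesgue W (\<lambda>w. h w * \<rho> w)"
  shows "measure M {s \<in> space M. \<omega> s \<in> W} * \<phi> (cond_expectation M \<omega> {s \<in> space M. \<omega> s \<in> W})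
    \<le> (LINT w:W|lebesgue. h w * \<rho> w)"
proof (cases "measure M {s \<in> space M. \<omega> s \<in> W} = 0")
  \<comment> \<open>For a null event the density vanishes almost everywhere on \<open>W\<close>, so
    both sides are 0.\<close>
  case True
  then have "AE w in lebesgue. \<rho> w * indicator W w = 0"
    using integral_nonneg_eq_0_iff_AE[OF integrable_density[OF W]] nonneg
    by (simp add: measure_eq_integral_density[OF W])
  then have "AE w in lebesgue. indicator W w *\<^sub>R (h w * \<rho> w) = 0"
    by eventually_elim auto
  then have "(LINT w:W|lebesgue. h w * \<rho> w) = 0"
    unfolding set_lebesgue_integral_def by (rule integral_eq_zero_AE)
  with True show ?thesis by simp
next
  case False
  then interpret weighted_barycenter W "\<lambda>w. \<rho> w * indicator W w"
    "cond_expectation M \<omega> {s \<in> space M. \<omega> s \<in> W}"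
    using W by (intro weighted_barycenter_cond_expectation) (simp_all add: zero_less_measure_iff)
  show ?thesis
    using jensen[OF \<phi> le] h
    by (simp add: measure_eq_integral_density[OF W] set_integrable_def set_lebesgue_integral_def
        ac_simps)
qed

section \<open>Relaxations of the expected value\<close>

text \<open>Joint convexity is used along two slices: with \<open>w\<close> fixed at the conditional
  mean it gives convexity in \<open>p\<close>, and with \<open>p\<close> fixed it gives Jensen's
  inequality on the cell. Summing over the cells preserves both, the weights being
  nonnegative.\<close>

lemma convex_relaxation_on_partition_relaxation:
  fixes P :: "'p::real_vector set"
  assumes part: "interval_partition S n \<Phi>" and P: "convex P"
    and exists: "\<And>p. p \<in> P \<Longrightarrow> expected_value_exists S \<rho> G p"
    and relax: "\<And>\<Omega>. \<Omega> \<in> compact_intervals S \<Longrightarrow>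
      convex_relaxation_on (P \<times> \<Omega>) (\<lambda>(p, w). G p w) (R P \<Omega>)"
  shows "convex_relaxation_on P (expected_value S \<rho> G) (partition_relaxation M \<omega> n \<Phi> R P)"
proof -
  interpret prob_space M by (rule prob)
  let ?A = "\<lambda>i. {s \<in> space M. \<omega> s \<in> \<Phi> i}"
  have mem: "\<Phi> i \<in> compact_intervals S" if "i \<in> {1..n}" for i
    using part that by (auto simp: interval_partition_def)
  have convex: "convex_on (P \<times> \<Phi> i) (R P (\<Phi> i))" if "i \<in> {1..n}" for i
    using relax[OF mem[OF that]] by (simp add: convex_relaxation_on_def)
  have "convex_on P (\<lambda>p. measure M (?A i) * R P (\<Phi> i) (p, cond_expectation M \<omega> (?A i)))"
    if i: "i \<in> {1..n}" for i
  proof (cases "measure M (?A i) = 0")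
    \<comment> \<open>The default conditional mean 0 of a null event may lie outside the cell, but
      its summand is constantly 0.\<close>
    case True
    then show ?thesis using P by (simp add: convex_on_const)
  next
    case False
    then interpret weighted_barycenter "\<Phi> i" "\<lambda>w. \<rho> w * indicator (\<Phi> i) w"
      "cond_expectation M \<omega> (?A i)"
      using compact_intervals_cart(1)[OF mem[OF i]]
      by (intro weighted_barycenter_cond_expectation) (simp_all add: zero_less_measure_iff)
    have m: "cond_expectation M \<omega> (?A i) \<in> \<Phi> i"
      using compact_intervals_cart(2)[OF mem[OF i]] by (rule barycenter_mem)
    have "convex_on P (\<lambda>p. R P (\<Phi> i) (p, cond_expectation M \<omega> (?A i)))"
      (is "convex_on P (\<lambda>p. ?R (p, ?m))")
    proof (rule convex_onI)
      \<comment> \<open>The second component is the same at both points, so it is unchanged by the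
        convex combination.\<close>
      fix t :: real and p q assume "0 < t" "t < 1" "p \<in> P" "q \<in> P"
      then show "?R ((1 - t) *\<^sub>R p + t *\<^sub>R q, ?m) \<le> (1 - t) * ?R (p, ?m) + t * ?R (q, ?m)"
        using convex_onD[OF convex[OF i], of t "(p, ?m)" "(q, ?m)"] m
        by (simp flip: scaleR_add_left)
    qed (rule P)
    then show ?thesis by (intro convex_on_cmul) simp_all
  qed
  then have "convex_on P (partition_relaxation M \<omega> n \<Phi> R P)"
    unfolding partition_relaxation_def[abs_def] by (rule convex_on_finite_sum[OF P])
  moreover have "partition_relaxation M \<omega> n \<Phi> R P p \<le> expected_value S \<rho> G p" if p: "p \<in> P" for p
  proof -
    have int: "set_integrable lebesgue S (\<lambda>w. G p w * \<rho> w)"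
      using exists[OF p] by (simp add: expected_value_exists_def)
    have "measure M (?A i) * R P (\<Phi> i) (p, cond_expectation M \<omega> (?A i))
        \<le> (LINT w:\<Phi> i|lebesgue. G p w * \<rho> w)" if i: "i \<in> {1..n}" for i
    proof (rule jensen_cond_expectation[where \<phi> = "\<lambda>w. R P (\<Phi> i) (p, w)"])
      show "compact (\<Phi> i)" by (rule compact_intervals_cart(1)[OF mem[OF i]])
      then have "\<Phi> i \<in> sets lebesgue" by (simp add: compact_imp_closed)
      then show "set_integrable lebesgue (\<Phi> i) (\<lambda>w. G p w * \<rho> w)"
        by (rule set_integrable_subset[OF int _ compact_intervals_cart(3)[OF mem[OF i]]])
      show "R P (\<Phi> i) (p, w) \<le> G p w" if "w \<in> \<Phi> i" for w
        using relax[OF mem[OF i]] p that by (auto simp: convex_relaxation_on_def)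
      show "convex_on (\<Phi> i) (\<lambda>w. R P (\<Phi> i) (p, w))"
      proof (rule convex_onI)
        fix t :: real and v w assume "0 < t" "t < 1" "v \<in> \<Phi> i" "w \<in> \<Phi> i"
        then show "R P (\<Phi> i) (p, (1 - t) *\<^sub>R v + t *\<^sub>R w)
            \<le> (1 - t) * R P (\<Phi> i) (p, v) + t * R P (\<Phi> i) (p, w)"
          using convex_onD[OF convex[OF i], of t "(p, v)" "(p, w)"] p
          by (simp flip: scaleR_add_left)
      qed (rule compact_intervals_cart(2)[OF mem[OF i]])
    qed
    then show ?thesis
      unfolding partition_relaxation_def expected_value_def
        integral_interval_partition[OF part int]
      by (intro sum_mono)
  qed
  ultimately show ?thesis by (simp add: convex_relaxation_on_def)
qed

text \<open>Both the expected value and the partition sum are odd under a change of sign, so the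
  convex case applies to \<open>- G\<close> and \<open>- R\<close>.\<close>

lemma concave_relaxation_on_partition_relaxation:
  fixes P :: "'p::real_vector set"
  assumes part: "interval_partition S n \<Phi>" and P: "convex P"
    and exists: "\<And>p. p \<in> P \<Longrightarrow> expected_value_exists S \<rho> G p"
    and relax: "\<And>\<Omega>. \<Omega> \<in> compact_intervals S \<Longrightarrow>
      concave_relaxation_on (P \<times> \<Omega>) (\<lambda>(p, w). G p w) (R P \<Omega>)"
  shows "concave_relaxation_on P (expected_value S \<rho> G) (partition_relaxation M \<omega> n \<Phi> R P)"
proof -
  have "convex_relaxation_on P (expected_value S \<rho> (\<lambda>p w. - G p w))
      (partition_relaxation M \<omega> n \<Phi> (\<lambda>P \<Omega> z. - R P \<Omega> z) P)"
  proof (rule convex_relaxation_on_partition_relaxation[OF part P])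
    show "expected_value_exists S \<rho> (\<lambda>p w. - G p w) p" if "p \<in> P" for p
      using exists[OF that] by (simp add: expected_value_exists_def set_integrable_def)
    show "convex_relaxation_on (P \<times> \<Omega>) (\<lambda>(p, w). - G p w) (\<lambda>z. - R P \<Omega> z)"
      if "\<Omega> \<in> compact_intervals S" for \<Omega>
      using relax[OF that]
      by (auto simp: convex_relaxation_on_def concave_relaxation_on_def concave_on_def)
  qed
  moreover have "expected_value S \<rho> (\<lambda>p w. - G p w) = (\<lambda>p. - expected_value S \<rho> G p)"
    by (simp add: fun_eq_iff expected_value_def set_lebesgue_integral_def)
  moreover have "partition_relaxation M \<omega> n \<Phi> (\<lambda>P \<Omega> z. - R P \<Omega> z) P
      = (\<lambda>p. - partition_relaxation M \<omega> n \<Phi> R P p)"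
    by (simp add: fun_eq_iff partition_relaxation_def sum_negf)
  ultimately show ?thesis
    by (simp add: convex_relaxation_on_def concave_relaxation_on_def concave_on_def)
qed

end

theorem theorem8:
  fixes M :: "'s measure"
    and \<omega> :: "'s \<Rightarrow> real ^ 'nw"
    and \<rho> :: "real ^ 'nw \<Rightarrow> real"
    and Pbar :: "(real ^ 'np) set"
    and \<Omega>bar :: "(real ^ 'nw) set"
    and t0 tf :: real
    and x0 :: "real ^ 'np \<Rightarrow> real ^ 'nw \<Rightarrow> real ^ 'nx"
    and f :: "real \<Rightarrow> real ^ 'np \<Rightarrow> real ^ 'nw \<Rightarrow> real ^ 'nx \<Rightarrow> real ^ 'nx"
    and x :: "real \<Rightarrow> real ^ 'np \<Rightarrow> real ^ 'nw \<Rightarrow> real ^ 'nx"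
    and g :: "real ^ 'np \<Rightarrow> real ^ 'nw \<Rightarrow> real ^ 'nx \<Rightarrow> real"
    and Gcv Gcc :: "(real ^ 'np) set \<Rightarrow> (real ^ 'nw) set \<Rightarrow> (real ^ 'np) \<times> (real ^ 'nw) \<Rightarrow> real"
    and n :: nat
    and \<Phi> :: "nat \<Rightarrow> (real ^ 'nw) set"
  assumes "t0 \<le> tf"
    and "Pbar \<in> compact_intervals UNIV"
    and "\<Omega>bar \<in> compact_intervals UNIV"
    and "prob_space M"
    and "distributed M lborel \<omega> (\<lambda>w. ennreal (\<rho> w))"
    and "\<And>w. 0 \<le> \<rho> w"
    and "\<And>w. w \<notin> \<Omega>bar \<Longrightarrow> \<rho> w = 0"
    and "locally_lipschitz (\<lambda>(p, w). x0 p w)"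
    and "locally_lipschitz (\<lambda>(t, p, w, z). f t p w z)"
    and "\<And>p w. p \<in> Pbar \<Longrightarrow> w \<in> \<Omega>bar \<Longrightarrow>
           is_unique_ivp_solution t0 tf (\<lambda>t z. f t p w z) (x0 p w) (\<lambda>t. x t p w)"
    and "\<And>p. p \<in> Pbar \<Longrightarrow> expected_value_exists \<Omega>bar \<rho> (terminal_value g x tf) p"
    and "\<And>P \<Omega>. P \<in> compact_intervals Pbar \<Longrightarrow> \<Omega> \<in> compact_intervals \<Omega>bar \<Longrightarrow>
           convex_relaxation_on (P \<times> \<Omega>) (\<lambda>(p, w). terminal_value g x tf p w) (Gcv P \<Omega>)"
    and "\<And>P \<Omega>. P \<in> compact_intervals Pbar \<Longrightarrow> \<Omega> \<in> compact_intervals \<Omega>bar \<Longrightarrow>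
           concave_relaxation_on (P \<times> \<Omega>) (\<lambda>(p, w). terminal_value g x tf p w) (Gcc P \<Omega>)"
    and "interval_partition \<Omega>bar n \<Phi>"
  shows "\<forall>P \<in> compact_intervals Pbar.
           convex_relaxation_on P (expected_value \<Omega>bar \<rho> (terminal_value g x tf))
             (partition_relaxation M \<omega> n \<Phi> Gcv P) \<and>
           concave_relaxation_on P (expected_value \<Omega>bar \<rho> (terminal_value g x tf))
             (partition_relaxation M \<omega> n \<Phi> Gcc P)"
proof (intro ballI conjI)
  fix P assume P: "P \<in> compact_intervals Pbar"
  \<comment> \<open>The box \<open>P\<close> lies in \<open>Pbar\<close>, so existence of the
    expected value carries over to its points.\<close>
  note exists = assms(11)[OF subsetD[OF compact_intervals_cart(3)[OF P]]]
  show "convex_relaxation_on P (expected_value \<Omega>bar \<rho> (terminal_value g x tf))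
      (partition_relaxation M \<omega> n \<Phi> Gcv P)"
    using assms(14) compact_intervals_cart(2)[OF P] exists assms(12)[OF P]
    by (rule convex_relaxation_on_partition_relaxation[OF assms(4-6)])
  show "concave_relaxation_on P (expected_value \<Omega>bar \<rho> (terminal_value g x tf))
      (partition_relaxation M \<omega> n \<Phi> Gcc P)"
    using assms(14) compact_intervals_cart(2)[OF P] exists assms(13)[OF P]
    by (rule concave_relaxation_on_partition_relaxation[OF assms(4-6)])
qed

end
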